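(* Let $\alpha,\beta\in CBV^*[0,1]$ and $v,w\in CBV[0,1]$ satisfy: $\alpha[e]=\beta[e]=0$ where $e\equiv1$; $|\alpha[v]-\beta[v]|<1$; and $v(t)+w(t)=1$ for all $t\in[0,1]$. Let $p\in(1,+\infty]$, $q\in[1,+\infty)$ with $p^{-1}+q^{-1}=1$. Let $f\colon[0,1]\times\mathbb R\to\mathbb R$ satisfy: $t\mapsto f(t,u)$ is Lebesgue measurable for every $u$; $u\mapsto f(t,u)$ is continuous for a.e. $t$; there exist a non-decreasing $\psi\colon[0,+\infty)\to[0,+\infty)$ and $\phi\in L^p([0,1])$, $\phi\ge0$, with $|f(t,u)|\le\phi(t)\psi(|u|)$ for all $t\in[0,1]$, $u\in\mathbb R$; and $\lim_{r\to+\infty}\psi(r)/r=0$. Let $k\colon[0,1]^2\to\mathbb R$ satisfy: $s\mapsto k(t,s)$ is in $L^q([0,1])$ for every $t$; there is $m\in L^q([0,1])$, $m\ge0$, with $\operatorname{var}_{[0,1]}k(\cdot,s)\le m(s)$ for a.e. $s$; and $\lim_{t\to\tau}\int_0^1|k(t,s)-k(\tau,s)|\phi(s)\,ds=0$ for every $\tau\in[0,1]$. Then the equation $x(t)=\alpha[x]v(t)+\beta[x]w(t)+\int_0^1k(t,s)f(s,x(s))\,ds$, $t\in[0,1]$, has a solution $x\in CBV[0,1]$.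
   Context: $BV[0,1]$ is the Banach space of real functions of bounded Jordan variation on $[0,1]$ with norm $\|f\|_{BV}=|f(0)|+\operatorname{var}_{[0,1]}f$; $CBV[0,1]$ is its closed subspace of continuous functions, and $CBV^*[0,1]$ its dual (continuous linear functionals). *)

theory Defs
  imports "HOL-Analysis.Analysis"
begin

definition jvar :: "(real \<Rightarrow> real) \<Rightarrow> real \<Rightarrow> real \<Rightarrow> ereal" where
  "jvar f a b = (SUP P \<in> {(n::nat, t::nat \<Rightarrow> real). t 0 = a \<and> t n = b \<and> (\<forall>i<n. t i \<le> t (Suc i))}.
      ereal (\<Sum>i<fst P. \<bar>f (snd P (Suc i)) - f (snd P i)\<bar>))"

text \<open>CBV[0,1]: continuous functions of bounded variation on [0,1] (values outside [0,1] are irrelevant).\<close>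
definition CBV :: "(real \<Rightarrow> real) set" where
  "CBV = {x. continuous_on {0..1} x \<and> jvar x 0 1 < \<infinity>}"

definition bv_norm :: "(real \<Rightarrow> real) \<Rightarrow> real" where
  "bv_norm x = \<bar>x 0\<bar> + real_of_ereal (jvar x 0 1)"

definition CBV_dual :: "((real \<Rightarrow> real) \<Rightarrow> real) set" where
  "CBV_dual = {\<alpha>. (\<forall>x\<in>CBV. \<forall>y\<in>CBV. \<forall>a b::real.
                      \<alpha> (\<lambda>t. a * x t + b * y t) = a * \<alpha> x + b * \<alpha> y)
                 \<and> (\<exists>C. \<forall>x\<in>CBV. \<bar>\<alpha> x\<bar> \<le> C * bv_norm x)}"

definition Lp01 :: "ereal \<Rightarrow> (real \<Rightarrow> real) \<Rightarrow> bool" where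
  "Lp01 p g \<longleftrightarrow> g \<in> borel_measurable (lebesgue_on {0..1}) \<and>
     (if p = \<infinity> then (\<exists>C. AE s in lebesgue_on {0..1}. \<bar>g s\<bar> \<le> C)
      else integrable (lebesgue_on {0..1}) (\<lambda>s. \<bar>g s\<bar> powr real_of_ereal p))"

end

theory Submission
  imports Defs "HOL-Complex_Analysis.Great_Picard"
begin

text \<open>
  Write \<open>K g t = \<integral> k t s * g s ds\<close>. Since \<open>w = 1 - v\<close> and both functionals vanish on constants, applying
  \<open>\<alpha>\<close> and \<open>\<beta>\<close> to the equation \<open>x = (\<alpha> x - \<beta> x) v + \<beta> x + y\<close> determines \<open>\<alpha> x\<close> and \<open>\<beta> x\<close> from
  \<open>y\<close>; so the problem is the fixed point equation \<open>x = y + c y * v + d y\<close>, \<open>y = K (f(\<cdot>, x))\<close>, with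
  bounded functionals \<open>c\<close>, \<open>d\<close> on \<open>CBV\<close>. The functionals are not continuous for uniform convergence, but
  \<open>K\<close> gains regularity: \<open>\<parallel>K g\<parallel>\<close> in \<open>BV\<close> is at most \<open>\<integral> (\<bar>k 0 s\<bar> + m s) * \<bar>g s\<bar> ds\<close>, so by dominated
  convergence the right-hand side is continuous in \<open>x\<close> even for bounded pointwise convergence, and it is
  equicontinuous in \<open>t\<close>. Sublinearity of \<open>\<psi>\<close> gives an invariant ball, and a Schauder argument in the
  supremum norm applies.
\<close>

section \<open>Fixed points\<close>

text \<open>The cube is indexed by natural numbers because its dimension has to vary in the Schauder argument;
  the library version of Brouwer's theorem fixes the dimension by a type.\<close>

lemma brouwer_cube_nat:
  fixes G :: "(nat \<Rightarrow> real) \<Rightarrow> nat \<Rightarrow> real" and R :: real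
  assumes "R > 0"
    and into: "\<And>x i. (\<And>j. j < n \<Longrightarrow> \<bar>x j\<bar> \<le> R) \<Longrightarrow> i < n \<Longrightarrow> \<bar>G x i\<bar> \<le> R"
    and cont: "\<And>X x i. (\<And>N j. j < n \<Longrightarrow> \<bar>X N j\<bar> \<le> R) \<Longrightarrow> (\<And>j. j < n \<Longrightarrow> (\<lambda>N. X N j) \<longlonglongrightarrow> x j)
                 \<Longrightarrow> i < n \<Longrightarrow> (\<lambda>N. G (X N) i) \<longlonglongrightarrow> G x i"
  obtains x where "\<And>j. j < n \<Longrightarrow> \<bar>x j\<bar> \<le> R" and "\<And>i. i < n \<Longrightarrow> G x i = x i"
proof -
  \<comment> \<open>\<open>c N\<close> carries the integer grid with coordinates from 0 to
    \<open>Suc N\<close> affinely onto grid points of the cube with sides [-R, R]; the mesh is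
    \<open>2 * R / real (Suc N)\<close>.\<close>
  define c :: "nat \<Rightarrow> (nat \<Rightarrow> nat) \<Rightarrow> nat \<Rightarrow> real"
    where "c = (\<lambda>N x i. R * (2 * real (x i) / real (Suc N) - 1))"
  have c_bd: "\<bar>c N x i\<bar> \<le> R" if "x i \<le> Suc N" for N x i
  proof -
    have "0 \<le> 2 * real (x i) / real (Suc N)" "2 * real (x i) / real (Suc N) \<le> 2"
      using that by (auto simp: divide_simps)
    then have "\<bar>2 * real (x i) / real (Suc N) - 1\<bar> \<le> 1" by linarith
    then show ?thesis
      using \<open>R > 0\<close> mult_left_le[of "\<bar>2 * real (x i) / real (Suc N) - 1\<bar>" R]
      by (simp add: c_def abs_mult)
  qed
  \<comment> \<open>Kuhn labelling: 0 records that \<open>G\<close> does not decrease the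
    coordinate, 1 that \<open>G\<close> does not increase it. On opposite faces Kuhn's lemma
    prescribes the labels; they keep this meaning there because \<open>G\<close> maps into the
    cube.\<close>
  define label where "label = (\<lambda>N x i. if x i = 0 then 0 else if x i = Suc N then 1
      else if c N x i \<le> G (c N x) i then 0 else (1::nat))"
  have label0: "c N x i \<le> G (c N x) i" if "\<And>j. j < n \<Longrightarrow> x j \<le> Suc N" "i < n" "label N x i = 0" for N x i
  proof (cases "x i = 0")
    case True
    have "\<bar>G (c N x) i\<bar> \<le> R" using into[of "c N x" i] c_bd that by auto
    with True show ?thesis by (simp add: c_def)
  qed (use that in \<open>auto simp: label_def split: if_splits\<close>)
  have label1: "G (c N x) i \<le> c N x i" if "\<And>j. j < n \<Longrightarrow> x j \<le> Suc N" "i < n" "label N x i = 1" for N x i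
  proof (cases "x i = Suc N")
    case True
    have "\<bar>G (c N x) i\<bar> \<le> R" using into[of "c N x" i] c_bd that by auto
    moreover have "c N x i = R"
      using True by (simp add: c_def field_simps)
    ultimately show ?thesis by simp
  qed (use that in \<open>auto simp: label_def split: if_splits\<close>)
  \<comment> \<open>Combinatorial core: a unit cell with lowest corner \<open>q\<close> on which
    each label coordinate takes both values. As the mesh tends to 0, such cells shrink, along a
    subsequence, to a fixed point.\<close>
  have "\<exists>q. (\<forall>i<n. q i < Suc N) \<and> (\<forall>i<n. \<exists>r s. (\<forall>j<n. q j \<le> r j \<and> r j \<le> q j + 1) \<and>
          (\<forall>j<n. q j \<le> s j \<and> s j \<le> q j + 1) \<and> label N r i \<noteq> label N s i)" for N
  proof (rule kuhn_lemma[of "Suc N" n "label N"])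
    fix q assume "\<forall>i<n. q i < Suc N"
      and "\<forall>i<n. \<exists>r s. (\<forall>j<n. q j \<le> r j \<and> r j \<le> q j + 1) \<and>
          (\<forall>j<n. q j \<le> s j \<and> s j \<le> q j + 1) \<and> label N r i \<noteq> label N s i"
    then show ?thesis by blast
  qed (simp_all add: label_def)
  from choice[OF allI[OF this]] obtain q where "\<forall>N. (\<forall>i<n. q N i < Suc N) \<and>
      (\<forall>i<n. \<exists>r s. (\<forall>j<n. q N j \<le> r j \<and> r j \<le> q N j + 1) \<and>
          (\<forall>j<n. q N j \<le> s j \<and> s j \<le> q N j + 1) \<and> label N r i \<noteq> label N s i)" ..
  then have q: "\<And>N i. i < n \<Longrightarrow> q N i < Suc N"
    and q2: "\<And>N i. i < n \<Longrightarrow> \<exists>r s. (\<forall>j<n. q N j \<le> r j \<and> r j \<le> q N j + 1) \<and>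
          (\<forall>j<n. q N j \<le> s j \<and> s j \<le> q N j + 1) \<and> label N r i \<noteq> label N s i"
    by auto
  \<comment> \<open>The premise \<open>i < n\<close> sits inside the existential so that choice
    yields a vertex for all \<open>N\<close> and \<open>i\<close> at once.\<close>
  have ex: "\<exists>r. i < n \<longrightarrow> (\<forall>j<n. q N j \<le> r j \<and> r j \<le> q N j + 1) \<and> label N r i = l"
    if "l \<in> {0,1}" for N i l
  proof (cases "i < n")
    case True
    obtain r s where rs: "\<forall>j<n. q N j \<le> r j \<and> r j \<le> q N j + 1"
        "\<forall>j<n. q N j \<le> s j \<and> s j \<le> q N j + 1" "label N r i \<noteq> label N s i"
      using q2[OF True, of N] by blast
    have "label N x i = 0 \<or> label N x i = 1" for x by (simp add: label_def)
    then have "label N r i = l \<or> label N s i = l"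
      using rs(3) that by (metis empty_iff insert_iff)
    then show ?thesis using rs by blast
  qed simp
  have "\<forall>N i. \<exists>r. i < n \<longrightarrow> (\<forall>j<n. q N j \<le> r j \<and> r j \<le> q N j + 1) \<and> label N r i = 0"
    using ex by simp
  then obtain r where "\<forall>N i. i < n \<longrightarrow>
      (\<forall>j<n. q N j \<le> r N i j \<and> r N i j \<le> q N j + 1) \<and> label N (r N i) i = 0"
    unfolding choice_iff ..
  then have r: "\<And>N i j. i < n \<Longrightarrow> j < n \<Longrightarrow> q N j \<le> r N i j \<and> r N i j \<le> q N j + 1"
    and lab_r: "\<And>N i. i < n \<Longrightarrow> label N (r N i) i = 0"
    by auto
  have "\<forall>N i. \<exists>s. i < n \<longrightarrow> (\<forall>j<n. q N j \<le> s j \<and> s j \<le> q N j + 1) \<and> label N s i = 1"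
    using ex by simp
  then obtain s where "\<forall>N i. i < n \<longrightarrow>
      (\<forall>j<n. q N j \<le> s N i j \<and> s N i j \<le> q N j + 1) \<and> label N (s N i) i = 1"
    unfolding choice_iff ..
  then have s: "\<And>N i j. i < n \<Longrightarrow> j < n \<Longrightarrow> q N j \<le> s N i j \<and> s N i j \<le> q N j + 1"
    and lab_s: "\<And>N i. i < n \<Longrightarrow> label N (s N i) i = 1"
    by auto
  have r_le: "r N i j \<le> Suc N" and s_le: "s N i j \<le> Suc N" if "i < n" "j < n" for N i j
    using r[OF that, of N] s[OF that, of N] q[OF that(2), of N] by auto
  have "norm (c N (q N) j) \<le> R" if "j \<in> {..<n}" for N j
    using c_bd q that by (simp add: less_imp_le)
  then obtain \<sigma> where \<sigma>: "strict_mono (\<sigma>::nat\<Rightarrow>nat)"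
    and "\<And>j. j \<in> {..<n} \<Longrightarrow> \<exists>l. (\<lambda>N. c (\<sigma> N) (q (\<sigma> N)) j) \<longlonglongrightarrow> l"
    using function_convergent_subsequence[of "{..<n}" "\<lambda>N. c N (q N)" R] by (metis countable_finite finite_lessThan)
  then obtain x where x: "\<And>j. j < n \<Longrightarrow> (\<lambda>N. c (\<sigma> N) (q (\<sigma> N)) j) \<longlonglongrightarrow> x j"
    by (metis lessThan_iff)
  have x_bd: "\<bar>x j\<bar> \<le> R" if "j < n" for j
    using tendsto_rabs[OF x[OF that]] c_bd q that
    by (intro LIMSEQ_le_const2[of "\<lambda>N. \<bar>c (\<sigma> N) (q (\<sigma> N)) j\<bar>"]) (auto simp: less_imp_le)
  \<comment> \<open>Any vertex of the cell differs from its lowest corner by at most one mesh width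
    in each coordinate, so all choices of vertices share the limit \<open>x\<close>.\<close>
  have close: "(\<lambda>N. c (\<sigma> N) (y (\<sigma> N)) j) \<longlonglongrightarrow> x j"
    if "j < n" and y: "\<And>N. q N j \<le> y N j \<and> y N j \<le> q N j + 1" for y j
  proof -
    have d: "\<bar>c N (y N) j - c N (q N) j\<bar> \<le> 2 * R / real (Suc N)" for N
    proof -
      have "c N (y N) j - c N (q N) j = (2 * R / real (Suc N)) * (real (y N j) - real (q N j))"
        by (simp add: c_def divide_simps) (simp add: algebra_simps)
      moreover have "\<bar>real (y N j) - real (q N j)\<bar> \<le> 1" using y[of N] by auto
      ultimately show ?thesis
        using \<open>R > 0\<close> mult_left_mono[of "\<bar>real (y N j) - real (q N j)\<bar>" 1 "2 * R / real (Suc N)"]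
        by (simp add: abs_mult)
    qed
    have "(\<lambda>N. 2 * R / real (Suc N)) \<longlonglongrightarrow> 0"
      using tendsto_mult[OF tendsto_const[of "2*R"] LIMSEQ_inverse_real_of_nat] by (simp add: divide_inverse)
    then have "(\<lambda>N. c N (y N) j - c N (q N) j) \<longlonglongrightarrow> 0"
      by (rule tendsto_rabs_zero_cancel[OF tendsto_sandwich[rotated 3]]) (use d in auto)
    from tendsto_add[OF LIMSEQ_subseq_LIMSEQ[OF this \<sigma>] x[OF \<open>j < n\<close>]] show ?thesis
      by (simp add: o_def)
  qed
  \<comment> \<open>The inequality at the vertices labelled 1 and the opposite one at those labelled
    0 both survive the limit, and both sequences of vertices tend to \<open>x\<close>.\<close>
  have "G x i = x i" if i: "i < n" for i
  proof (rule antisym)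
    have "(\<lambda>N. G (c (\<sigma> N) (s (\<sigma> N) i)) i) \<longlonglongrightarrow> G x i"
      using i s s_le by (intro cont c_bd close) auto
    moreover have "(\<lambda>N. c (\<sigma> N) (s (\<sigma> N) i) i) \<longlonglongrightarrow> x i"
      using i s by (intro close) auto
    ultimately show "G x i \<le> x i"
      by (rule LIMSEQ_le) (use label1 s_le lab_s i in auto)
    have "(\<lambda>N. c (\<sigma> N) (r (\<sigma> N) i) i) \<longlonglongrightarrow> x i"
      using i r by (intro close) auto
    moreover have "(\<lambda>N. G (c (\<sigma> N) (r (\<sigma> N) i)) i) \<longlonglongrightarrow> G x i"
      using i r r_le by (intro cont c_bd close) auto
    ultimately show "x i \<le> G x i"
      by (rule LIMSEQ_le) (use label0 r_le lab_r i in auto)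
  qed
  with x_bd show ?thesis using that by blast
qed

text \<open>Pointwise continuity on bounded measurable functions is strong enough to discretise with step
  functions: their values at the nodes are a fixed point of a map of a finite-dimensional cube.\<close>

lemma schauder_bounded_measurable:
  fixes T :: "(real \<Rightarrow> real) \<Rightarrow> real \<Rightarrow> real" and R :: real
  defines "D \<equiv> {x \<in> borel_measurable (lebesgue_on {0..1}). \<forall>s\<in>{0..1}. \<bar>x s\<bar> \<le> R}"
  assumes "R > 0"
    and into: "\<And>x t. x \<in> D \<Longrightarrow> t \<in> {0..1} \<Longrightarrow> \<bar>T x t\<bar> \<le> R"
    and cont: "\<And>X x t. (\<And>N. X N \<in> D) \<Longrightarrow> x \<in> D \<Longrightarrow> (\<And>s. s \<in> {0..1} \<Longrightarrow> (\<lambda>N. X N s) \<longlonglongrightarrow> x s)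
                 \<Longrightarrow> t \<in> {0..1} \<Longrightarrow> (\<lambda>N. T (X N) t) \<longlonglongrightarrow> T x t"
    and equicont: "\<And>\<tau> e. \<tau> \<in> {0..1} \<Longrightarrow> e > 0 \<Longrightarrow>
                 \<exists>d>0. \<forall>x\<in>D. \<forall>t\<in>{0..1}. \<bar>\<tau> - t\<bar> < d \<longrightarrow> \<bar>T x \<tau> - T x t\<bar> < e"
  obtains x where "x \<in> D" "continuous_on {0..1} x" "\<And>t. t \<in> {0..1} \<Longrightarrow> T x t = x t"
proof -
  \<comment> \<open>On [0,1], \<open>L N c\<close> is the step function whose value on each interval
    of length \<open>1 / real (Suc N)\<close> is attached to its left node. The index
    \<open>Suc N\<close> occurs at \<open>s = 1\<close> only, which is why there are
    \<open>Suc (Suc N)\<close> nodes.\<close>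
  define L :: "nat \<Rightarrow> (nat \<Rightarrow> real) \<Rightarrow> real \<Rightarrow> real"
    where "L = (\<lambda>N c s. c (nat \<lfloor>s * real (Suc N)\<rfloor>))"
  have idx: "nat \<lfloor>s * real (Suc N)\<rfloor> < Suc (Suc N)" if "s \<in> {0..1}" for s N
  proof -
    have "s * real (Suc N) \<le> 1 * real (Suc N)" using that by (intro mult_right_mono) auto
    from floor_mono[OF this] have "\<lfloor>s * real (Suc N)\<rfloor> \<le> int (Suc N)"
      unfolding mult_1 floor_of_nat .
    then show ?thesis by linarith
  qed
  have L_D: "L N c \<in> D" if "\<And>j. j < Suc (Suc N) \<Longrightarrow> \<bar>c j\<bar> \<le> R" for N c
  proof -
    have "L N c \<in> borel_measurable borel" unfolding L_def by measurable
    then have "L N c \<in> borel_measurable (lebesgue_on {0..1})"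
      by (intro measurable_restrict_space1 measurable_completion) auto
    then show ?thesis using that idx by (auto simp: D_def L_def)
  qed
  have "\<exists>c. (\<forall>j<Suc (Suc N). \<bar>c j\<bar> \<le> R) \<and> (\<forall>i<Suc (Suc N). T (L N c) (real i / real (Suc N)) = c i)" for N
  proof (rule brouwer_cube_nat[of R "Suc (Suc N)" "\<lambda>c i. T (L N c) (real i / real (Suc N))"])
    show "\<bar>T (L N x) (real i / real (Suc N))\<bar> \<le> R"
      if "\<And>j. j < Suc (Suc N) \<Longrightarrow> \<bar>x j\<bar> \<le> R" "i < Suc (Suc N)" for x i
      using that by (intro into L_D) auto
    show "(\<lambda>M. T (L N (X M)) (real i / real (Suc N))) \<longlonglongrightarrow> T (L N x) (real i / real (Suc N))"
      if "\<And>M j. j < Suc (Suc N) \<Longrightarrow> \<bar>X M j\<bar> \<le> R"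
        "\<And>j. j < Suc (Suc N) \<Longrightarrow> (\<lambda>M. X M j) \<longlonglongrightarrow> x j" "i < Suc (Suc N)" for X x i
    proof (intro cont L_D)
      show "\<bar>x j\<bar> \<le> R" if "j < Suc (Suc N)" for j
        using tendsto_rabs[OF \<open>\<And>j. j < Suc (Suc N) \<Longrightarrow> (\<lambda>M. X M j) \<longlonglongrightarrow> x j\<close>[OF that]]
          \<open>\<And>M j. j < Suc (Suc N) \<Longrightarrow> \<bar>X M j\<bar> \<le> R\<close>[OF that]
        by (intro LIMSEQ_le_const2[of "\<lambda>M. \<bar>X M j\<bar>"]) auto
    qed (use that idx in \<open>auto simp: L_def\<close>)
  qed (use \<open>R > 0\<close> in auto)
  then obtain c where c: "\<And>N j. j < Suc (Suc N) \<Longrightarrow> \<bar>c N j\<bar> \<le> R"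
    and fix_c: "\<And>N i. i < Suc (Suc N) \<Longrightarrow> T (L N (c N)) (real i / real (Suc N)) = c N i"
    by metis
  define U where "U = (\<lambda>N. T (L N (c N)))"
  have LcD: "L N (c N) \<in> D" for N using c L_D by blast
  \<comment> \<open>The step functions jump, so compactness is sought for their images under
    \<open>T\<close>: these are equicontinuous and share the nodal values
    \<open>c N\<close>.\<close>
  obtain g \<sigma> where g: "continuous_on {0..1} g" and \<sigma>: "strict_mono (\<sigma> :: nat \<Rightarrow> nat)"
    and lim: "\<And>e. 0 < e \<Longrightarrow> \<exists>M. \<forall>N x. N \<ge> M \<and> x \<in> {0..1} \<longrightarrow> norm (U (\<sigma> N) x - g x) < e"
  proof (rule Arzela_Ascoli[of "{0..1::real}" U R])
    show "\<exists>d>0. \<forall>N y. y \<in> {0..1} \<and> norm (x - y) < d \<longrightarrow> norm (U N x - U N y) < e"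
      if "x \<in> {0..1}" "0 < e" for x e
      using equicont[OF that] LcD unfolding U_def real_norm_def by blast
  qed (use into LcD in \<open>auto simp: U_def\<close>)
  have Ug: "(\<lambda>N. U (\<sigma> N) t) \<longlonglongrightarrow> g t" if "t \<in> {0..1}" for t
    using lim that by (intro LIMSEQ_I) blast
  have "\<bar>g t\<bar> \<le> R" if "t \<in> {0..1}" for t
    using tendsto_rabs[OF Ug[OF that]] into LcD that
    by (intro LIMSEQ_le_const2[of "\<lambda>N. \<bar>U (\<sigma> N) t\<bar>"]) (auto simp: U_def)
  then have gD: "g \<in> D"
    using continuous_imp_measurable_on_sets_lebesgue[OF g] by (auto simp: D_def)
  \<comment> \<open>\<open>\<rho> N s\<close> is the node just left of \<open>s\<close>. By the
    choice of \<open>c N\<close>, the step function is \<open>U N\<close> sampled at this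
    node.\<close>
  define \<rho> where "\<rho> = (\<lambda>N s. real (nat \<lfloor>s * real (Suc N)\<rfloor>) / real (Suc N))"
  have LU: "L N (c N) s = U N (\<rho> N s)" if "s \<in> {0..1}" for N s
    unfolding U_def \<rho>_def using fix_c[OF idx[OF that]] by (simp add: L_def)
  have \<rho>01: "\<rho> N s \<in> {0..1}" if "s \<in> {0..1}" for N s
    using idx[OF that, of N] by (auto simp: \<rho>_def divide_simps)
  have \<rho>_lim: "(\<lambda>N. \<rho> N s) \<longlonglongrightarrow> s" if "s \<in> {0..1}" for s
  proof -
    have "\<bar>\<rho> N s - s\<bar> \<le> inverse (real (Suc N))" for N
    proof -
      have "0 \<le> s * real (Suc N)" using that by simp
      then have "\<bar>real (nat \<lfloor>s * real (Suc N)\<rfloor>) - s * real (Suc N)\<bar> \<le> 1" by linarith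
      moreover have "\<rho> N s - s = (real (nat \<lfloor>s * real (Suc N)\<rfloor>) - s * real (Suc N)) / real (Suc N)"
        by (simp add: \<rho>_def diff_divide_distrib)
      ultimately show ?thesis by (simp add: abs_divide divide_simps)
    qed
    then have "(\<lambda>N. \<rho> N s - s) \<longlonglongrightarrow> 0"
      by (intro tendsto_rabs_zero_cancel[OF tendsto_sandwich[OF _ _ tendsto_const LIMSEQ_inverse_real_of_nat]]) auto
    then show ?thesis by (simp add: LIM_zero_iff)
  qed
  \<comment> \<open>Uniform convergence of \<open>U (\<sigma> N)\<close> handles the moving
    argument, and continuity of \<open>g\<close> handles the passage from the node to
    \<open>s\<close>. This is the bounded pointwise convergence that \<open>cont\<close>
    requires.\<close>
  have Llim: "(\<lambda>N. L (\<sigma> N) (c (\<sigma> N)) s) \<longlonglongrightarrow> g s" if s: "s \<in> {0..1}" for s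
  proof -
    have "(\<lambda>N. g (\<rho> (\<sigma> N) s)) \<longlonglongrightarrow> g s"
      using LIMSEQ_subseq_LIMSEQ[OF \<rho>_lim[OF s] \<sigma>] s \<rho>01[OF s]
      by (intro continuous_on_tendsto_compose[OF g]) (auto simp: o_def)
    moreover have "(\<lambda>N. U (\<sigma> N) (\<rho> (\<sigma> N) s) - g (\<rho> (\<sigma> N) s)) \<longlonglongrightarrow> 0"
      using lim \<rho>01[OF s] by (intro LIMSEQ_I) (metis diff_zero)
    ultimately show ?thesis
      using tendsto_add LU[OF s] by fastforce
  qed
  have "T g t = g t" if t: "t \<in> {0..1}" for t
  proof -
    have "(\<lambda>N. T (L (\<sigma> N) (c (\<sigma> N))) t) \<longlonglongrightarrow> T g t"
      using cont[OF LcD gD Llim t] .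
    with Ug[OF t] show ?thesis
      unfolding U_def using LIMSEQ_unique by blast
  qed
  with gD g that show ?thesis by blast
qed

section \<open>Functions of bounded variation\<close>

lemma monotone_partition_bounds:
  fixes t :: "nat \<Rightarrow> real"
  assumes "\<forall>i<n. t i \<le> t (Suc i)" "i \<le> n"
  shows "t i \<in> {t 0..t n}"
proof -
  have "t j \<le> t l" if "j \<le> l" "l \<le> n" for j l
    using that
  proof (induction l rule: dec_induct)
    case (step l)
    then show ?case using assms(1) by (metis Suc_leD Suc_le_lessD order_trans)
  qed simp
  then show ?thesis using assms(2) by auto
qed

lemma jvar_le_iff:
  "jvar f a b \<le> ereal C \<longleftrightarrow> (\<forall>n t. t 0 = a \<longrightarrow> t n = b \<longrightarrow> (\<forall>i<n. t i \<le> t (Suc i)) \<longrightarrow>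
     (\<Sum>i<n. \<bar>f (t (Suc i)) - f (t i)\<bar>) \<le> C)"
  unfolding jvar_def SUP_le_iff by auto

text \<open>Functions here are total on the reals, while identities for the integral operator hold
  on [0,1] only; this transfers them to the variation.\<close>

lemma jvar_cong:
  assumes "\<And>t. t \<in> {a..b} \<Longrightarrow> f t = g t"
  shows "jvar f a b = jvar g a b"
  unfolding jvar_def
proof (rule SUP_cong[OF refl])
  fix P :: "nat \<times> (nat \<Rightarrow> real)"
  assume "P \<in> {(n, t). t 0 = a \<and> t n = b \<and> (\<forall>i<n. t i \<le> t (Suc i))}"
  then obtain n t where P: "P = (n, t)" "t 0 = a" "t n = b" "\<forall>i<n. t i \<le> t (Suc i)" by auto
  have "f (t i) = g (t i)" if "i \<le> n" for i
    using monotone_partition_bounds[OF P(4) that] P by (intro assms) auto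
  then show "ereal (\<Sum>i<fst P. \<bar>f (snd P (Suc i)) - f (snd P i)\<bar>)
      = ereal (\<Sum>i<fst P. \<bar>g (snd P (Suc i)) - g (snd P i)\<bar>)"
    by (simp add: P(1))
qed

lemma abs_diff_le_jvar:
  assumes "a \<le> c" "c \<le> b"
  shows "ereal \<bar>f c - f a\<bar> \<le> jvar f a b"
proof -
  define t where "t = (\<lambda>i::nat. if i = 0 then a else if i = 1 then c else b)"
  have "ereal \<bar>f c - f a\<bar> \<le> ereal (\<Sum>i<fst (2::nat, t). \<bar>f (snd (2::nat, t) (Suc i)) - f (snd (2::nat, t) i)\<bar>)"
    by (simp add: t_def numeral_2_eq_2)
  also have "\<dots> \<le> jvar f a b"
    unfolding jvar_def using assms by (intro SUP_upper) (auto simp: t_def)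
  finally show ?thesis .
qed

lemma jvar_nonneg: "a \<le> b \<Longrightarrow> 0 \<le> jvar f a b"
  using abs_diff_le_jvar[of a a b f] by (simp add: zero_ereal_def)

lemma jvar_lincomb_le:
  assumes "jvar x a b \<le> ereal V" "jvar y a b \<le> ereal W"
  shows "jvar (\<lambda>t. c * x t + d * y t) a b \<le> ereal (\<bar>c\<bar> * V + \<bar>d\<bar> * W)"
  unfolding jvar_le_iff
proof (intro allI impI)
  fix n and t :: "nat \<Rightarrow> real"
  assume t: "t 0 = a" "t n = b" "\<forall>i<n. t i \<le> t (Suc i)"
  have "(\<Sum>i<n. \<bar>c * x (t (Suc i)) + d * y (t (Suc i)) - (c * x (t i) + d * y (t i))\<bar>)
      \<le> (\<Sum>i<n. \<bar>c\<bar> * \<bar>x (t (Suc i)) - x (t i)\<bar> + \<bar>d\<bar> * \<bar>y (t (Suc i)) - y (t i)\<bar>)"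
  proof (rule sum_mono)
    fix i
    have "c * x (t (Suc i)) + d * y (t (Suc i)) - (c * x (t i) + d * y (t i))
        = c * (x (t (Suc i)) - x (t i)) + d * (y (t (Suc i)) - y (t i))"
      by (simp add: algebra_simps)
    then show "\<bar>c * x (t (Suc i)) + d * y (t (Suc i)) - (c * x (t i) + d * y (t i))\<bar>
        \<le> \<bar>c\<bar> * \<bar>x (t (Suc i)) - x (t i)\<bar> + \<bar>d\<bar> * \<bar>y (t (Suc i)) - y (t i)\<bar>"
      by (metis abs_mult abs_triangle_ineq)
  qed
  also have "\<dots> = \<bar>c\<bar> * (\<Sum>i<n. \<bar>x (t (Suc i)) - x (t i)\<bar>) + \<bar>d\<bar> * (\<Sum>i<n. \<bar>y (t (Suc i)) - y (t i)\<bar>)"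
    by (simp add: sum.distrib sum_distrib_left)
  also have "\<dots> \<le> \<bar>c\<bar> * V + \<bar>d\<bar> * W"
    using assms t unfolding jvar_le_iff by (intro add_mono mult_left_mono) auto
  finally show "(\<Sum>i<n. \<bar>c * x (t (Suc i)) + d * y (t (Suc i)) - (c * x (t i) + d * y (t i))\<bar>)
      \<le> \<bar>c\<bar> * V + \<bar>d\<bar> * W" .
qed

text \<open>Nonnegativity excludes the value minus infinity, so finiteness becomes a real bound, the
  form in which \<open>jvar_le_iff\<close> speaks about partitions.\<close>

lemma CBV_iff: "x \<in> CBV \<longleftrightarrow> continuous_on {0..1} x \<and> (\<exists>V. jvar x 0 1 \<le> ereal V)"
proof -
  have "jvar x 0 1 < \<infinity> \<longleftrightarrow> (\<exists>V. jvar x 0 1 \<le> ereal V)"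
    using jvar_nonneg[of 0 1 x] by (cases "jvar x 0 1") auto
  then show ?thesis by (simp add: CBV_def)
qed

lemma CBV_lincomb: "x \<in> CBV \<Longrightarrow> y \<in> CBV \<Longrightarrow> (\<lambda>t. c * x t + d * y t) \<in> CBV"
  unfolding CBV_iff by (auto intro!: continuous_intros dest: jvar_lincomb_le[of x 0 1 _ y _ c d])

lemma CBV_const: "(\<lambda>t. c) \<in> CBV"
  unfolding CBV_iff by (auto simp: jvar_le_iff intro!: exI[of _ 0])

lemma bv_norm_nonneg: "0 \<le> bv_norm x"
  using jvar_nonneg[of 0 1 x] by (simp add: bv_norm_def real_of_ereal_pos)

lemma bv_norm_le:
  assumes "jvar x 0 1 \<le> ereal V"
  shows "bv_norm x \<le> \<bar>x 0\<bar> + V"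
  using assms jvar_nonneg[of 0 1 x] by (cases "jvar x 0 1") (auto simp: bv_norm_def)

lemma CBV_dual_linear:
  assumes "\<alpha> \<in> CBV_dual" "x \<in> CBV" "y \<in> CBV"
  shows "\<alpha> (\<lambda>t. a * x t + b * y t) = a * \<alpha> x + b * \<alpha> y"
  using assms by (simp add: CBV_dual_def)

lemma CBV_dual_bound:
  assumes "\<alpha> \<in> CBV_dual"
  obtains C where "C \<ge> 0" "\<And>x. x \<in> CBV \<Longrightarrow> \<bar>\<alpha> x\<bar> \<le> C * bv_norm x"
proof -
  obtain C where C: "\<And>x. x \<in> CBV \<Longrightarrow> \<bar>\<alpha> x\<bar> \<le> C * bv_norm x"
    using assms unfolding CBV_dual_def by blast
  have "\<bar>\<alpha> x\<bar> \<le> \<bar>C\<bar> * bv_norm x" if "x \<in> CBV" for x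
    using C[OF that] mult_right_mono[OF abs_ge_self[of C] bv_norm_nonneg[of x]] by linarith
  then show ?thesis using that[of "\<bar>C\<bar>"] by simp
qed

lemma CBV_dual_lincomb:
  assumes "\<alpha> \<in> CBV_dual" "\<beta> \<in> CBV_dual"
  shows "(\<lambda>x. a * \<alpha> x + b * \<beta> x) \<in> CBV_dual"
proof -
  obtain A where "A \<ge> 0" and A: "\<And>x. x \<in> CBV \<Longrightarrow> \<bar>\<alpha> x\<bar> \<le> A * bv_norm x"
    using CBV_dual_bound[OF assms(1)] by blast
  obtain B where "B \<ge> 0" and B: "\<And>x. x \<in> CBV \<Longrightarrow> \<bar>\<beta> x\<bar> \<le> B * bv_norm x"
    using CBV_dual_bound[OF assms(2)] by blast
  have "\<bar>a * \<alpha> x + b * \<beta> x\<bar> \<le> (\<bar>a\<bar> * A + \<bar>b\<bar> * B) * bv_norm x" if "x \<in> CBV" for x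
  proof -
    have "\<bar>a * \<alpha> x + b * \<beta> x\<bar> \<le> \<bar>a\<bar> * \<bar>\<alpha> x\<bar> + \<bar>b\<bar> * \<bar>\<beta> x\<bar>"
      by (metis abs_mult abs_triangle_ineq)
    also have "\<dots> \<le> \<bar>a\<bar> * (A * bv_norm x) + \<bar>b\<bar> * (B * bv_norm x)"
      using A[OF that] B[OF that] by (intro add_mono mult_left_mono) auto
    finally show ?thesis by (simp add: algebra_simps)
  qed
  moreover have "a * \<alpha> (\<lambda>t. c * x t + d * y t) + b * \<beta> (\<lambda>t. c * x t + d * y t)
      = c * (a * \<alpha> x + b * \<beta> x) + d * (a * \<alpha> y + b * \<beta> y)" if "x \<in> CBV" "y \<in> CBV" for x y c d
    using CBV_dual_linear[OF assms(1) that] CBV_dual_linear[OF assms(2) that]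
    by (simp add: algebra_simps)
  ultimately show ?thesis
    unfolding CBV_dual_def by blast
qed

section \<open>Integrability and measurability\<close>

text \<open>The integrability part of Hoelder's theorem. For finite \<open>p\<close> Young's
  inequality gives a pointwise integrable majorant of the product; for infinite \<open>p\<close> a
  constant multiple of \<open>\<bar>h s\<bar>\<close> serves.\<close>

lemma integrable_Lp01_mult:
  assumes "p > 1" "q \<ge> 1"
    and pq: "if p = \<infinity> then q = 1 else 1 / real_of_ereal p + 1 / q = 1"
    and g: "Lp01 p g" and h: "Lp01 (ereal q) h"
  shows "integrable (lebesgue_on {0..1}) (\<lambda>s. h s * g s)"
proof -
  have gm[measurable]: "g \<in> borel_measurable (lebesgue_on {0..1})"
    and hm[measurable]: "h \<in> borel_measurable (lebesgue_on {0..1})"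
    and hi: "integrable (lebesgue_on {0..1}) (\<lambda>s. \<bar>h s\<bar> powr q)"
    using g h by (auto simp: Lp01_def)
  show ?thesis
  proof (cases "p = \<infinity>")
    case True
    then obtain C where C: "AE s in lebesgue_on {0..1}. \<bar>g s\<bar> \<le> C"
      using g by (auto simp: Lp01_def)
    have "integrable (lebesgue_on {0..1}) (\<lambda>s. C * \<bar>h s\<bar>)"
      using hi True pq by simp
    then show ?thesis
    proof (rule Bochner_Integration.integrable_bound)
      show "AE s in lebesgue_on {0..1}. norm (h s * g s) \<le> norm (C * \<bar>h s\<bar>)"
        using C
      proof eventually_elim
        case (elim s)
        then have "\<bar>h s\<bar> * \<bar>g s\<bar> \<le> \<bar>h s\<bar> * \<bar>C\<bar>" by (intro mult_left_mono) auto
        then show ?case by (simp add: abs_mult mult.commute)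
      qed
    qed measurable
  next
    case False
    define p' where "p' = real_of_ereal p"
    have "p' > 1" using False \<open>p > 1\<close> by (cases p) (auto simp: p'_def)
    have eq: "1 / p' + 1 / q = 1" using False pq by (simp add: p'_def)
    then have "q > 1" using \<open>p' > 1\<close> \<open>q \<ge> 1\<close> by (cases "q = 1") auto
    have gi: "integrable (lebesgue_on {0..1}) (\<lambda>s. \<bar>g s\<bar> powr p')"
      using g False by (auto simp: Lp01_def p'_def)
    have "integrable (lebesgue_on {0..1}) (\<lambda>s. \<bar>g s\<bar> powr p' / p' + \<bar>h s\<bar> powr q / q)"
      using gi hi by simp
    then show ?thesis
    proof (rule Bochner_Integration.integrable_bound)
      show "AE s in lebesgue_on {0..1}. norm (h s * g s) \<le> norm (\<bar>g s\<bar> powr p' / p' + \<bar>h s\<bar> powr q / q)"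
        using Youngs_inequality[OF \<open>p' > 1\<close> \<open>q > 1\<close> eq]
        by (intro AE_I2) (simp add: abs_mult, smt (verit) abs_ge_zero mult.commute)
    qed measurable
  qed
qed

text \<open>Completeness of Lebesgue measure, applied to the extensions by zero to the whole
  space.\<close>

lemma borel_measurable_lebesgue_on_AE:
  fixes g h :: "'a::euclidean_space \<Rightarrow> 'b::euclidean_space"
  assumes S: "S \<in> sets lebesgue" and "g \<in> borel_measurable (lebesgue_on S)"
    and ae: "AE x in lebesgue_on S. g x = h x"
  shows "h \<in> borel_measurable (lebesgue_on S)"
proof -
  have "AE x in lebesgue. (if x \<in> S then g x else 0) = (if x \<in> S then h x else 0)"
    using ae S by (subst (asm) AE_restrict_space_iff) (auto elim: eventually_mono)
  moreover have "(\<lambda>x. if x \<in> S then g x else 0) \<in> borel_measurable lebesgue"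
    using assms(2) S by (simp add: borel_measurable_if)
  ultimately have "(\<lambda>x. if x \<in> S then h x else 0) \<in> borel_measurable lebesgue"
    by (rule borel_measurable_AE[rotated])
  then show ?thesis
    using S by (simp add: borel_measurable_if)
qed

text \<open>Rounding \<open>x\<close> down to a grid gives functions with countably many values, for
  which the superposition is patched from the measurable sections of \<open>f\<close>. Continuity in
  the second argument passes to the limit almost everywhere.\<close>

lemma caratheodory_superposition_measurable:
  fixes f :: "real \<Rightarrow> real \<Rightarrow> real"
  assumes S: "S \<in> sets lebesgue"
    and f_meas: "\<And>u. (\<lambda>t. f t u) \<in> borel_measurable (lebesgue_on S)"
    and f_cont: "AE t in lebesgue_on S. continuous_on UNIV (f t)"
    and [measurable]: "x \<in> borel_measurable (lebesgue_on S)"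
  shows "(\<lambda>t. f t (x t)) \<in> borel_measurable (lebesgue_on S)"
proof -
  define y where "y = (\<lambda>n t. of_int \<lfloor>x t * real (Suc n)\<rfloor> / real (Suc n))"
  have y_lim: "(\<lambda>n. y n t) \<longlonglongrightarrow> x t" for t
  proof -
    have "\<bar>y n t - x t\<bar> \<le> inverse (real (Suc n))" for n
    proof -
      have "\<bar>of_int \<lfloor>x t * real (Suc n)\<rfloor> - x t * real (Suc n)\<bar> \<le> 1" by linarith
      moreover have "y n t - x t = (of_int \<lfloor>x t * real (Suc n)\<rfloor> - x t * real (Suc n)) / real (Suc n)"
        by (simp add: y_def diff_divide_distrib)
      ultimately show ?thesis by (simp add: abs_divide divide_right_mono inverse_eq_divide)
    qed
    then have "(\<lambda>n. y n t - x t) \<longlonglongrightarrow> 0"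
      by (intro tendsto_rabs_zero_cancel[OF tendsto_sandwich[OF _ _ tendsto_const LIMSEQ_inverse_real_of_nat]]) auto
    then show ?thesis by (simp add: LIM_zero_iff)
  qed
  have [measurable]: "(\<lambda>t. f t (y n t)) \<in> borel_measurable (lebesgue_on S)" for n
  proof -
    have "(\<lambda>t. \<lfloor>x t * real (Suc n)\<rfloor>) \<in> measurable (lebesgue_on S) (count_space UNIV)"
      by measurable
    from measurable_compose_countable[OF f_meas this, of "\<lambda>i. of_int i / real (Suc n)"]
    show ?thesis by (simp add: y_def)
  qed
  \<comment> \<open>As \<open>lim\<close> is total, this function is measurable also across the null
    set where the sequence may diverge; there it is only a modification of the desired
    limit.\<close>
  have "(\<lambda>t. lim (\<lambda>n. f t (y n t))) \<in> borel_measurable (lebesgue_on S)"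
    by measurable
  moreover have "AE t in lebesgue_on S. lim (\<lambda>n. f t (y n t)) = f t (x t)"
    using f_cont
  proof eventually_elim
    case (elim t)
    then have "(\<lambda>n. f t (y n t)) \<longlonglongrightarrow> f t (x t)"
      by (rule continuous_on_tendsto_compose[OF _ y_lim]) auto
    then show ?case by (rule limI)
  qed
  ultimately show ?thesis by (rule borel_measurable_lebesgue_on_AE[OF S])
qed

section \<open>The integral operator\<close>

text \<open>The exponents enter through Hoelder's theorem alone, so only its outcome is recorded,
  for \<open>k 0\<close> and \<open>m\<close> against \<open>\<phi>\<close>; the other sections
  \<open>k t\<close> are controlled by the variation.\<close>

locale variation_kernel =
  fixes k :: "real \<Rightarrow> real \<Rightarrow> real" and m \<phi> :: "real \<Rightarrow> real"
  assumes k_meas: "t \<in> {0..1} \<Longrightarrow> k t \<in> borel_measurable (lebesgue_on {0..1})"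
    and m_meas: "m \<in> borel_measurable (lebesgue_on {0..1})"
    and \<phi>_meas: "\<phi> \<in> borel_measurable (lebesgue_on {0..1})"
    and m_nonneg: "s \<in> {0..1} \<Longrightarrow> 0 \<le> m s"
    and \<phi>_nonneg: "s \<in> {0..1} \<Longrightarrow> 0 \<le> \<phi> s"
    and k0_integrable: "integrable (lebesgue_on {0..1}) (\<lambda>s. k 0 s * \<phi> s)"
    and m_integrable: "integrable (lebesgue_on {0..1}) (\<lambda>s. m s * \<phi> s)"
    and k_var: "AE s in lebesgue_on {0..1}. jvar (\<lambda>t. k t s) 0 1 \<le> ereal (m s)"
    and k_cont: "\<tau> \<in> {0..1} \<Longrightarrow>
       ((\<lambda>t. integral\<^sup>L (lebesgue_on {0..1}) (\<lambda>s. \<bar>k t s - k \<tau> s\<bar> * \<phi> s)) \<longlongrightarrow> 0) (at \<tau> within {0..1})"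
begin

abbreviation M :: "real measure" where "M \<equiv> lebesgue_on {0..1}"

text \<open>For almost every \<open>s\<close> this bounds both the values
  \<open>\<bar>k t s\<bar>\<close> with \<open>t\<close> in [0,1] and the BV norm of the section of
  \<open>k\<close> in its first argument.\<close>

definition weight :: "real \<Rightarrow> real" where "weight s = \<bar>k 0 s\<bar> + m s"

definition K :: "(real \<Rightarrow> real) \<Rightarrow> real \<Rightarrow> real" where "K g t = integral\<^sup>L M (\<lambda>s. k t s * g s)"

text \<open>The constant is explicit for the sake of uniformity: all superpositions of
  \<open>f\<close> with measurable functions bounded by \<open>R\<close> on [0,1] are dominated with
  the same constant \<open>\<psi> R\<close>.\<close>

definition dominated :: "real \<Rightarrow> (real \<Rightarrow> real) \<Rightarrow> bool" where
  "dominated C g \<longleftrightarrow> g \<in> borel_measurable M \<and> (\<forall>s\<in>{0..1}. \<bar>g s\<bar> \<le> C * \<phi> s)"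

section \<open>Integrability against the weight\<close>

lemma weight_meas: "weight \<in> borel_measurable M"
proof -
  have [measurable]: "k 0 \<in> borel_measurable M" "m \<in> borel_measurable M"
    using k_meas m_meas by auto
  show ?thesis unfolding weight_def by measurable
qed

lemma weight_nonneg: "s \<in> {0..1} \<Longrightarrow> 0 \<le> weight s"
  using m_nonneg by (simp add: weight_def)

lemma weight_\<phi>_integrable: "integrable M (\<lambda>s. weight s * \<phi> s)"
proof -
  have "integrable M (\<lambda>s. \<bar>k 0 s * \<phi> s\<bar> + m s * \<phi> s)"
    using k0_integrable m_integrable by auto
  then show ?thesis
    by (rule Bochner_Integration.integrable_cong[THEN iffD1, rotated 2])
      (auto simp: weight_def abs_mult \<phi>_nonneg distrib_right)
qed

text \<open>Serves for \<open>h\<close> equal to \<open>weight\<close>, to \<open>m\<close> and to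
  each section \<open>k t\<close>.\<close>

lemma dominated_integrable:
  assumes g: "dominated C g" and h: "h \<in> borel_measurable M" and le: "AE s in M. \<bar>h s\<bar> \<le> weight s"
  shows "integrable M (\<lambda>s. h s * g s)"
proof (rule Bochner_Integration.integrable_bound)
  show "integrable M (\<lambda>s. C * (weight s * \<phi> s))" using weight_\<phi>_integrable by simp
  show "(\<lambda>s. h s * g s) \<in> borel_measurable M"
    using g h by (auto simp: dominated_def)
  show "AE s in M. norm (h s * g s) \<le> norm (C * (weight s * \<phi> s))"
    using le AE_space
  proof eventually_elim
    case (elim s)
    then have "\<bar>h s\<bar> * \<bar>g s\<bar> \<le> weight s * (C * \<phi> s)"
      using g weight_nonneg[of s] by (intro mult_mono) (auto simp: dominated_def)
    also have "\<dots> \<le> \<bar>C * (weight s * \<phi> s)\<bar>" by (simp add: mult.left_commute)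
    finally show ?case by (simp add: abs_mult)
  qed
qed

lemma dominated_diff:
  assumes "dominated C g" "dominated D h"
  shows "dominated (C + D) (\<lambda>s. g s - h s)"
proof -
  have "\<bar>g s - h s\<bar> \<le> (C + D) * \<phi> s" if "s \<in> {0..1}" for s
  proof -
    have "\<bar>g s\<bar> \<le> C * \<phi> s" "\<bar>h s\<bar> \<le> D * \<phi> s"
      using assms that by (auto simp: dominated_def)
    then show ?thesis unfolding distrib_right by linarith
  qed
  moreover have "(\<lambda>s. g s - h s) \<in> borel_measurable M"
    using assms by (auto simp: dominated_def)
  ultimately show ?thesis by (simp add: dominated_def)
qed

lemma dominated_abs: "dominated C g \<Longrightarrow> dominated C (\<lambda>s. \<bar>g s\<bar>)"
  by (auto simp: dominated_def)

lemma weight_abs_integrable: "dominated C g \<Longrightarrow> integrable M (\<lambda>s. weight s * \<bar>g s\<bar>)"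
  using weight_nonneg by (intro dominated_integrable dominated_abs weight_meas AE_I2) auto

lemma weight_abs_integral_le:
  assumes "dominated C g"
  shows "integral\<^sup>L M (\<lambda>s. weight s * \<bar>g s\<bar>) \<le> C * integral\<^sup>L M (\<lambda>s. weight s * \<phi> s)"
proof -
  have "integral\<^sup>L M (\<lambda>s. weight s * \<bar>g s\<bar>) \<le> integral\<^sup>L M (\<lambda>s. C * (weight s * \<phi> s))"
  proof (rule integral_mono)
    show "integrable M (\<lambda>s. weight s * \<bar>g s\<bar>)" using weight_abs_integrable[OF assms] .
    show "integrable M (\<lambda>s. C * (weight s * \<phi> s))" using weight_\<phi>_integrable by simp
    show "weight s * \<bar>g s\<bar> \<le> C * (weight s * \<phi> s)" if "s \<in> space M" for s
    proof -
      have "weight s * \<bar>g s\<bar> \<le> weight s * (C * \<phi> s)"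
        using that assms weight_nonneg[of s] by (intro mult_left_mono) (auto simp: dominated_def)
      then show ?thesis by (simp add: mult.left_commute)
    qed
  qed
  then show ?thesis by simp
qed

text \<open>The variation controls the increments from 0 to every \<open>t\<close> simultaneously,
  so a single null set works for all \<open>t\<close>.\<close>

lemma k_le_weight: "AE s in M. \<forall>t\<in>{0..1}. \<bar>k t s\<bar> \<le> weight s"
  using k_var
proof eventually_elim
  case (elim s)
  have "\<bar>k t s - k 0 s\<bar> \<le> m s" if "t \<in> {0..1}" for t
    using order_trans[OF abs_diff_le_jvar[of 0 t 1 "\<lambda>t. k t s"] elim] that by simp
  then show ?case unfolding weight_def by (smt (verit))
qed

section \<open>Size, continuity and variation of \<open>K g\<close>\<close>

lemma K_integrable:
  assumes "dominated C g" "t \<in> {0..1}"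
  shows "integrable M (\<lambda>s. k t s * g s)"
  using k_le_weight assms(2) by (intro dominated_integrable[OF assms(1)] k_meas) (auto elim: eventually_mono)

lemma K_bound:
  assumes "dominated C g" "t \<in> {0..1}"
  shows "\<bar>K g t\<bar> \<le> integral\<^sup>L M (\<lambda>s. weight s * \<bar>g s\<bar>)"
proof -
  have "\<bar>K g t\<bar> \<le> integral\<^sup>L M (\<lambda>s. \<bar>k t s * g s\<bar>)"
    unfolding K_def by (rule integral_abs_bound)
  also have "\<dots> \<le> integral\<^sup>L M (\<lambda>s. weight s * \<bar>g s\<bar>)"
  proof (rule integral_mono_AE)
    show "integrable M (\<lambda>s. \<bar>k t s * g s\<bar>)" using K_integrable[OF assms] by simp
    show "integrable M (\<lambda>s. weight s * \<bar>g s\<bar>)" using weight_abs_integrable[OF assms(1)] .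
    show "AE s in M. \<bar>k t s * g s\<bar> \<le> weight s * \<bar>g s\<bar>"
      using k_le_weight by eventually_elim (use assms(2) in \<open>auto simp: abs_mult intro: mult_right_mono\<close>)
  qed
  finally show ?thesis .
qed

lemma k_diff_integrable:
  assumes "dominated C g" "t \<in> {0..1}" "\<tau> \<in> {0..1}"
  shows "integrable M (\<lambda>s. \<bar>k t s - k \<tau> s\<bar> * \<bar>g s\<bar>)"
proof -
  have "integrable M (\<lambda>s. k t s * g s - k \<tau> s * g s)"
    using K_integrable[OF assms(1)] assms by simp
  from integrable_abs[OF this] show ?thesis
    by (simp add: abs_mult flip: left_diff_distrib)
qed

lemma K_diff_le:
  assumes "dominated C g" "t \<in> {0..1}" "\<tau> \<in> {0..1}"
  shows "\<bar>K g t - K g \<tau>\<bar> \<le> integral\<^sup>L M (\<lambda>s. \<bar>k t s - k \<tau> s\<bar> * \<bar>g s\<bar>)"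
proof -
  have "K g t - K g \<tau> = integral\<^sup>L M (\<lambda>s. (k t s - k \<tau> s) * g s)"
    using K_integrable[OF assms(1)] assms by (simp add: K_def left_diff_distrib)
  then have "\<bar>K g t - K g \<tau>\<bar> \<le> integral\<^sup>L M (\<lambda>s. \<bar>(k t s - k \<tau> s) * g s\<bar>)"
    using integral_abs_bound by metis
  then show ?thesis by (simp add: abs_mult)
qed

lemma dominated_\<phi>: "dominated 1 \<phi>"
  using \<phi>_nonneg \<phi>_meas by (simp add: dominated_def)

text \<open>The bound depends on \<open>g\<close> through \<open>C\<close> alone, so it gives
  equicontinuity of the images of a whole dominated class, besides continuity of each
  \<open>K g\<close>.\<close>

lemma K_modulus:
  assumes "dominated C g" "t \<in> {0..1}" "\<tau> \<in> {0..1}"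
  shows "\<bar>K g t - K g \<tau>\<bar> \<le> C * integral\<^sup>L M (\<lambda>s. \<bar>k t s - k \<tau> s\<bar> * \<phi> s)"
proof -
  have "integral\<^sup>L M (\<lambda>s. \<bar>k t s - k \<tau> s\<bar> * \<bar>g s\<bar>) \<le> integral\<^sup>L M (\<lambda>s. C * (\<bar>k t s - k \<tau> s\<bar> * \<phi> s))"
  proof (rule integral_mono)
    show "integrable M (\<lambda>s. \<bar>k t s - k \<tau> s\<bar> * \<bar>g s\<bar>)" using k_diff_integrable[OF assms] .
    have "integrable M (\<lambda>s. \<bar>k t s - k \<tau> s\<bar> * \<phi> s) \<longleftrightarrow> integrable M (\<lambda>s. \<bar>k t s - k \<tau> s\<bar> * \<bar>\<phi> s\<bar>)"
      by (intro Bochner_Integration.integrable_cong) (auto simp: \<phi>_nonneg)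
    then show "integrable M (\<lambda>s. C * (\<bar>k t s - k \<tau> s\<bar> * \<phi> s))"
      using k_diff_integrable[OF dominated_\<phi> assms(2,3)] by simp
    show "\<bar>k t s - k \<tau> s\<bar> * \<bar>g s\<bar> \<le> C * (\<bar>k t s - k \<tau> s\<bar> * \<phi> s)" if "s \<in> space M" for s
    proof -
      have "\<bar>k t s - k \<tau> s\<bar> * \<bar>g s\<bar> \<le> \<bar>k t s - k \<tau> s\<bar> * (C * \<phi> s)"
        using that assms(1) by (intro mult_left_mono) (auto simp: dominated_def)
      then show ?thesis by (simp add: mult.left_commute)
    qed
  qed
  with K_diff_le[OF assms] show ?thesis by simp
qed

lemma K_continuous:
  assumes "dominated C g"
  shows "continuous_on {0..1} (K g)"
  unfolding continuous_on_def
proof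
  fix \<tau> :: real assume \<tau>: "\<tau> \<in> {0..1}"
  let ?J = "\<lambda>t. C * integral\<^sup>L M (\<lambda>s. \<bar>k t s - k \<tau> s\<bar> * \<phi> s)"
  have "(?J \<longlongrightarrow> 0) (at \<tau> within {0..1})"
    using tendsto_mult_right_zero[OF k_cont[OF \<tau>]] .
  moreover have "\<forall>\<^sub>F t in at \<tau> within {0..1}. norm (K g t - K g \<tau>) \<le> ?J t"
    using K_modulus[OF assms _ \<tau>] by (auto simp: eventually_at_filter)
  ultimately have "((\<lambda>t. K g t - K g \<tau>) \<longlongrightarrow> 0) (at \<tau> within {0..1})"
    by (rule Lim_null_comparison[rotated])
  then show "(K g \<longlongrightarrow> K g \<tau>) (at \<tau> within {0..1})"
    by (simp add: LIM_zero_iff)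
qed

lemma m_abs_integrable:
  assumes "dominated C g"
  shows "integrable M (\<lambda>s. m s * \<bar>g s\<bar>)"
  using m_nonneg by (intro dominated_integrable[OF dominated_abs[OF assms]] m_meas AE_I2) (auto simp: weight_def)

text \<open>A partition sum of \<open>K g\<close> is estimated under the integral sign, where for
  almost every \<open>s\<close> the partition sum of the kernel is at most
  \<open>m s\<close>.\<close>

lemma K_jvar_le:
  assumes "dominated C g"
  shows "jvar (K g) 0 1 \<le> ereal (integral\<^sup>L M (\<lambda>s. m s * \<bar>g s\<bar>))"
  unfolding jvar_le_iff
proof (intro allI impI)
  fix n and t :: "nat \<Rightarrow> real"
  assume t: "t 0 = 0" "t n = 1" "\<forall>i<n. t i \<le> t (Suc i)"
  have t01: "t i \<in> {0..1}" if "i \<le> n" for i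
    using monotone_partition_bounds[OF t(3) that] t by simp
  have int: "integrable M (\<lambda>s. \<bar>k (t (Suc i)) s - k (t i) s\<bar> * \<bar>g s\<bar>)" if "i < n" for i
    using that by (intro k_diff_integrable[OF assms] t01) auto
  have "(\<Sum>i<n. \<bar>K g (t (Suc i)) - K g (t i)\<bar>)
      \<le> (\<Sum>i<n. integral\<^sup>L M (\<lambda>s. \<bar>k (t (Suc i)) s - k (t i) s\<bar> * \<bar>g s\<bar>))"
    by (intro sum_mono K_diff_le[OF assms] t01) auto
  also have "\<dots> = integral\<^sup>L M (\<lambda>s. \<Sum>i<n. \<bar>k (t (Suc i)) s - k (t i) s\<bar> * \<bar>g s\<bar>)"
    using int by (subst Bochner_Integration.integral_sum) auto
  also have "\<dots> \<le> integral\<^sup>L M (\<lambda>s. m s * \<bar>g s\<bar>)"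
  proof (rule integral_mono_AE)
    show "integrable M (\<lambda>s. \<Sum>i<n. \<bar>k (t (Suc i)) s - k (t i) s\<bar> * \<bar>g s\<bar>)"
      using int by (intro Bochner_Integration.integrable_sum) auto
    show "integrable M (\<lambda>s. m s * \<bar>g s\<bar>)" using m_abs_integrable[OF assms] .
    show "AE s in M. (\<Sum>i<n. \<bar>k (t (Suc i)) s - k (t i) s\<bar> * \<bar>g s\<bar>) \<le> m s * \<bar>g s\<bar>"
      using k_var
    proof eventually_elim
      case (elim s)
      then have "(\<Sum>i<n. \<bar>k (t (Suc i)) s - k (t i) s\<bar>) \<le> m s"
        using t unfolding jvar_le_iff by blast
      then show ?case
        unfolding sum_distrib_right[symmetric] by (rule mult_right_mono) simp
    qed
  qed
  finally show "(\<Sum>i<n. \<bar>K g (t (Suc i)) - K g (t i)\<bar>) \<le> integral\<^sup>L M (\<lambda>s. m s * \<bar>g s\<bar>)" .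
qed

lemma K_CBV: "dominated C g \<Longrightarrow> K g \<in> CBV"
  using K_continuous K_jvar_le unfolding CBV_iff by blast

text \<open>This is the gain of regularity: a weighted L1 norm of \<open>g\<close> controls the BV
  norm of \<open>K g\<close>, so dominated convergence of the arguments yields convergence in
  BV.\<close>

lemma K_bv_norm_le:
  assumes "dominated C g"
  shows "bv_norm (K g) \<le> integral\<^sup>L M (\<lambda>s. weight s * \<bar>g s\<bar>)"
proof -
  have i1: "integrable M (\<lambda>s. \<bar>k 0 s\<bar> * \<bar>g s\<bar>)"
    using integrable_abs[OF K_integrable[OF assms, of 0]] by (simp add: abs_mult)
  have "bv_norm (K g) \<le> \<bar>K g 0\<bar> + integral\<^sup>L M (\<lambda>s. m s * \<bar>g s\<bar>)"
    using bv_norm_le[OF K_jvar_le[OF assms]] .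
  also have "\<bar>K g 0\<bar> \<le> integral\<^sup>L M (\<lambda>s. \<bar>k 0 s\<bar> * \<bar>g s\<bar>)"
    unfolding K_def using integral_abs_bound[of M "\<lambda>s. k 0 s * g s"] by (simp add: abs_mult)
  also have "integral\<^sup>L M (\<lambda>s. \<bar>k 0 s\<bar> * \<bar>g s\<bar>) + integral\<^sup>L M (\<lambda>s. m s * \<bar>g s\<bar>)
      = integral\<^sup>L M (\<lambda>s. weight s * \<bar>g s\<bar>)"
    using i1 m_abs_integrable[OF assms] by (simp add: weight_def distrib_right)
  finally show ?thesis by simp
qed

lemma K_diff:
  assumes "dominated C g" "dominated D h" "t \<in> {0..1}"
  shows "K (\<lambda>s. g s - h s) t = K g t - K h t"
  using K_integrable[OF assms(1,3)] K_integrable[OF assms(2,3)] by (simp add: K_def right_diff_distrib)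

text \<open>Composed with \<open>K\<close>, a bounded functional on \<open>CBV\<close> becomes
  Lipschitz for the weighted L1 distance, although it need not be continuous for uniform
  convergence.\<close>

lemma CBV_dual_K:
  assumes "\<alpha> \<in> CBV_dual"
  obtains B where "B \<ge> 0"
    and "\<And>C g. dominated C g \<Longrightarrow> \<bar>\<alpha> (K g)\<bar> \<le> B * integral\<^sup>L M (\<lambda>s. weight s * \<bar>g s\<bar>)"
    and "\<And>C D g h. dominated C g \<Longrightarrow> dominated D h \<Longrightarrow>
           \<bar>\<alpha> (K g) - \<alpha> (K h)\<bar> \<le> B * integral\<^sup>L M (\<lambda>s. weight s * \<bar>g s - h s\<bar>)"
proof -
  obtain B where B: "B \<ge> 0" "\<And>x. x \<in> CBV \<Longrightarrow> \<bar>\<alpha> x\<bar> \<le> B * bv_norm x"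
    using CBV_dual_bound[OF assms] by blast
  have bd: "\<bar>\<alpha> (K g)\<bar> \<le> B * integral\<^sup>L M (\<lambda>s. weight s * \<bar>g s\<bar>)" if "dominated C g" for C g
    using B(2)[OF K_CBV[OF that]] mult_left_mono[OF K_bv_norm_le[OF that] B(1)] by linarith
  have "\<bar>\<alpha> (K g) - \<alpha> (K h)\<bar> \<le> B * integral\<^sup>L M (\<lambda>s. weight s * \<bar>g s - h s\<bar>)"
    if g: "dominated C g" and h: "dominated D h" for C D g h
  proof -
    \<comment> \<open>This has the literal form required by linearity of \<open>\<alpha>\<close>. It
      is known to equal \<open>K (\<lambda>s. g s - h s)\<close> on [0,1] only, which suffices
      because the bound sees just the BV norm.\<close>
    let ?d = "\<lambda>t. 1 * K g t + (-1) * K h t"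
    have dC: "?d \<in> CBV" by (rule CBV_lincomb[OF K_CBV[OF g] K_CBV[OF h]])
    note gh = dominated_diff[OF g h]
    have d01: "?d t = K (\<lambda>s. g s - h s) t" if "t \<in> {0..1}" for t
      using K_diff[OF g h that] by simp
    have "jvar ?d 0 1 = jvar (K (\<lambda>s. g s - h s)) 0 1"
      using d01 by (rule jvar_cong)
    then have norm_d: "bv_norm ?d = bv_norm (K (\<lambda>s. g s - h s))"
      using d01[of 0] by (simp add: bv_norm_def)
    have "\<bar>\<alpha> ?d\<bar> \<le> B * integral\<^sup>L M (\<lambda>s. weight s * \<bar>g s - h s\<bar>)"
      using order_trans[OF B(2)[OF dC, unfolded norm_d] mult_left_mono[OF K_bv_norm_le[OF gh] B(1)]] .
    moreover have "\<alpha> ?d = \<alpha> (K g) - \<alpha> (K h)"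
      using CBV_dual_linear[OF assms K_CBV[OF g] K_CBV[OF h], of 1 "-1"] by simp
    ultimately show ?thesis by simp
  qed
  with bd B(1) that show ?thesis by blast
qed

section \<open>Solution of the fixed point equation\<close>

lemma hammerstein_fixed_point:
  fixes f :: "real \<Rightarrow> real \<Rightarrow> real"
  assumes c: "c \<in> CBV_dual" and d: "d \<in> CBV_dual" and v: "continuous_on {0..1} v"
    and f_meas: "\<And>u. (\<lambda>t. f t u) \<in> borel_measurable M"
    and f_cont: "AE t in M. continuous_on UNIV (f t)"
    and \<psi>_mono: "mono_on {0..} \<psi>" and \<psi>_nonneg: "\<And>r. r \<ge> 0 \<Longrightarrow> \<psi> r \<ge> 0"
    and f_bound: "\<And>t u. t \<in> {0..1} \<Longrightarrow> \<bar>f t u\<bar> \<le> \<phi> t * \<psi> \<bar>u\<bar>"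
    and \<psi>_sublin: "((\<lambda>r. \<psi> r / r) \<longlongrightarrow> 0) at_top"
  obtains x C where "dominated C (\<lambda>s. f s (x s))"
    and "\<And>t. t \<in> {0..1} \<Longrightarrow>
      x t = K (\<lambda>s. f s (x s)) t + c (K (\<lambda>s. f s (x s))) * v t + d (K (\<lambda>s. f s (x s)))"
proof -
  obtain Bc where Bc: "Bc \<ge> 0" "\<And>C g. dominated C g \<Longrightarrow> \<bar>c (K g)\<bar> \<le> Bc * integral\<^sup>L M (\<lambda>s. weight s * \<bar>g s\<bar>)"
    "\<And>C D g h. dominated C g \<Longrightarrow> dominated D h \<Longrightarrow>
           \<bar>c (K g) - c (K h)\<bar> \<le> Bc * integral\<^sup>L M (\<lambda>s. weight s * \<bar>g s - h s\<bar>)"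
    using CBV_dual_K[OF c] by blast
  obtain Bd where Bd: "Bd \<ge> 0" "\<And>C g. dominated C g \<Longrightarrow> \<bar>d (K g)\<bar> \<le> Bd * integral\<^sup>L M (\<lambda>s. weight s * \<bar>g s\<bar>)"
    "\<And>C D g h. dominated C g \<Longrightarrow> dominated D h \<Longrightarrow>
           \<bar>d (K g) - d (K h)\<bar> \<le> Bd * integral\<^sup>L M (\<lambda>s. weight s * \<bar>g s - h s\<bar>)"
    using CBV_dual_K[OF d] by blast
  have "bounded (v ` {0..1})"
    using v compact_Icc compact_continuous_image compact_imp_bounded by blast
  then obtain V where V: "\<And>t. t \<in> {0..1} \<Longrightarrow> \<bar>v t\<bar> \<le> V" and "V > 0"
    unfolding bounded_pos real_norm_def by blast
  define A where "A = integral\<^sup>L M (\<lambda>s. weight s * \<phi> s)"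
  have "A \<ge> 0" unfolding A_def using weight_nonneg \<phi>_nonneg by (intro integral_nonneg_AE AE_I2) auto
  \<comment> \<open>The three terms are the bounds for the three summands of \<open>T\<close>,
    relative to the weighted L1 norm of \<open>g x\<close>; the same \<open>W\<close> is a Lipschitz
    constant for \<open>T\<close>.\<close>
  define W where "W = 1 + Bc * V + Bd"
  have "W > 0" using Bc(1) Bd(1) \<open>V > 0\<close> by (simp add: W_def add_pos_nonneg)
  define g where "g = (\<lambda>x s. f s (x s))"
  define T where "T = (\<lambda>x t. K (g x) t + c (K (g x)) * v t + d (K (g x)))"

  \<comment> \<open>Sublinear growth yields a radius with \<open>\<psi> R * A * W \<le> R\<close>,
    which makes the ball invariant. The added 1 keeps the quotient meaningful when \<open>A\<close>
    is 0.\<close>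
  have "A * W + 1 > 0" using \<open>A \<ge> 0\<close> \<open>W > 0\<close> by (simp add: add_nonneg_pos)
  then have "\<forall>\<^sub>F r in at_top. \<psi> r / r < 1 / (A * W + 1)"
    by (intro order_tendstoD(2)[OF \<psi>_sublin]) simp
  then obtain R where "R > 0" and R: "\<psi> R / R < 1 / (A * W + 1)"
    using eventually_happens'[OF trivial_limit_at_top_linorder eventually_conj[OF eventually_gt_at_top[of 0]]]
    by blast
  have "\<psi> R * (A * W + 1) \<le> R"
    using R \<open>R > 0\<close> \<open>A * W + 1 > 0\<close> by (simp add: field_simps)
  moreover have "\<psi> R \<ge> 0" using \<psi>_nonneg \<open>R > 0\<close> by simp
  ultimately have \<psi>R: "\<psi> R * A * W \<le> R" by (simp add: algebra_simps)

  define D where "D = {x \<in> borel_measurable M. \<forall>s\<in>{0..1}. \<bar>x s\<bar> \<le> R}"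
  have dom: "dominated (\<psi> R) (g x)" if "x \<in> D" for x
  proof -
    have "\<bar>f s (x s)\<bar> \<le> \<psi> R * \<phi> s" if s: "s \<in> {0..1}" for s
    proof -
      have "\<psi> \<bar>x s\<bar> \<le> \<psi> R"
        using \<psi>_mono \<open>x \<in> D\<close> s \<open>R > 0\<close> by (auto simp: D_def intro: mono_onD)
      then have "\<phi> s * \<psi> \<bar>x s\<bar> \<le> \<phi> s * \<psi> R" using \<phi>_nonneg[OF s] by (rule mult_left_mono)
      with f_bound[OF s, of "x s"] show ?thesis by (simp add: mult.commute)
    qed
    moreover have "(\<lambda>s. f s (x s)) \<in> borel_measurable M"
      by (rule caratheodory_superposition_measurable[OF _ f_meas f_cont]) (use that in \<open>simp_all add: D_def\<close>)
    ultimately show ?thesis by (simp add: dominated_def g_def)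
  qed
  have gA: "integral\<^sup>L M (\<lambda>s. weight s * \<bar>g x s\<bar>) \<le> \<psi> R * A" if "x \<in> D" for x
    using weight_abs_integral_le[OF dom[OF that]] by (simp add: A_def)

  obtain x where x: "x \<in> D" "\<And>t. t \<in> {0..1} \<Longrightarrow> T x t = x t"
  proof (rule schauder_bounded_measurable[of R T, folded D_def])
    show "R > 0" by fact
  next
    fix x t assume x: "x \<in> D" and t: "t \<in> {0..1::real}"
    let ?I = "integral\<^sup>L M (\<lambda>s. weight s * \<bar>g x s\<bar>)"
    have "\<bar>c (K (g x)) * v t\<bar> \<le> (Bc * ?I) * V"
      unfolding abs_mult by (intro mult_mono' Bc(2)[OF dom[OF x]] V t) auto
    then have "\<bar>T x t\<bar> \<le> ?I + Bc * ?I * V + Bd * ?I"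
      using K_bound[OF dom[OF x] t] Bd(2)[OF dom[OF x]] by (simp add: T_def)
    also have "\<dots> = ?I * W" by (simp add: W_def algebra_simps)
    also have "\<dots> \<le> (\<psi> R * A) * W" using gA[OF x] \<open>W > 0\<close> by (intro mult_right_mono) auto
    also have "\<dots> \<le> R" by fact
    finally show "\<bar>T x t\<bar> \<le> R" .
  next
    fix X x t
    assume X: "\<And>N. X N \<in> D" and x: "x \<in> D" and lim: "\<And>s. s \<in> {0..1} \<Longrightarrow> (\<lambda>N. X N s) \<longlonglongrightarrow> x s"
      and t: "t \<in> {0..1::real}"
    note dd = dominated_diff[OF dom[OF X] dom[OF x]]
    let ?I = "\<lambda>N. integral\<^sup>L M (\<lambda>s. weight s * \<bar>g (X N) s - g x s\<bar>)"
    \<comment> \<open>Continuity of \<open>f s\<close> gives pointwise convergence for almost every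
      \<open>s\<close>, and both superpositions are dominated with constant \<open>\<psi> R\<close>,
      whence the majorant.\<close>
    have "?I \<longlonglongrightarrow> integral\<^sup>L M (\<lambda>s. 0)"
    proof (rule integral_dominated_convergence)
      show "integrable M (\<lambda>s. (\<psi> R + \<psi> R) * (weight s * \<phi> s))" using weight_\<phi>_integrable by simp
      show "(\<lambda>s. weight s * \<bar>g (X N) s - g x s\<bar>) \<in> borel_measurable M" for N
        using weight_abs_integrable[OF dd] by (rule borel_measurable_integrable)
      show "AE s in M. (\<lambda>N. weight s * \<bar>g (X N) s - g x s\<bar>) \<longlonglongrightarrow> 0"
        using f_cont AE_space
      proof eventually_elim
        case (elim s)
        then have "(\<lambda>N. f s (X N s)) \<longlonglongrightarrow> f s (x s)"
          by (intro continuous_on_tendsto_compose[OF elim(1) lim]) auto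
        then have "(\<lambda>N. \<bar>g (X N) s - g x s\<bar>) \<longlonglongrightarrow> 0"
          unfolding g_def by (intro tendsto_rabs_zero) (simp add: LIM_zero)
        then show ?case by (rule tendsto_mult_right_zero)
      qed
      show "AE s in M. norm (weight s * \<bar>g (X N) s - g x s\<bar>) \<le> (\<psi> R + \<psi> R) * (weight s * \<phi> s)" for N
      proof (rule AE_I2)
        fix s assume "s \<in> space M"
        then have "weight s * \<bar>g (X N) s - g x s\<bar> \<le> weight s * ((\<psi> R + \<psi> R) * \<phi> s)" "0 \<le> weight s"
          using dd[of N] weight_nonneg[of s] by (auto simp: dominated_def intro!: mult_left_mono)
        then show "norm (weight s * \<bar>g (X N) s - g x s\<bar>) \<le> (\<psi> R + \<psi> R) * (weight s * \<phi> s)"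
          by (simp add: abs_mult mult.left_commute)
      qed
    qed simp
    then have I0: "?I \<longlonglongrightarrow> 0" by simp
    have "norm (T (X N) t - T x t) \<le> ?I N * W" for N
    proof -
      have "\<bar>K (g (X N)) t - K (g x) t\<bar> \<le> ?I N"
        using K_bound[OF dd t] K_diff[OF dom[OF X] dom[OF x] t] by simp
      moreover have "\<bar>(c (K (g (X N))) - c (K (g x))) * v t\<bar> \<le> (Bc * ?I N) * V"
        unfolding abs_mult by (intro mult_mono' Bc(3)[OF dom[OF X] dom[OF x]] V t) auto
      moreover have "\<bar>d (K (g (X N))) - d (K (g x))\<bar> \<le> Bd * ?I N"
        using Bd(3)[OF dom[OF X] dom[OF x]] .
      moreover have "T (X N) t - T x t = (K (g (X N)) t - K (g x) t)
          + (c (K (g (X N))) - c (K (g x))) * v t + (d (K (g (X N))) - d (K (g x)))"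
        by (simp add: T_def algebra_simps)
      ultimately have "\<bar>T (X N) t - T x t\<bar> \<le> ?I N + (Bc * ?I N) * V + Bd * ?I N" by linarith
      then show ?thesis by (simp add: W_def algebra_simps)
    qed
    then have "(\<lambda>N. T (X N) t - T x t) \<longlonglongrightarrow> 0"
      by (intro Lim_null_comparison[OF _ tendsto_mult_left_zero[OF I0, of W]]) auto
    then show "(\<lambda>N. T (X N) t) \<longlonglongrightarrow> T x t" by (simp add: LIM_zero_iff)
  next
    fix \<tau> e :: real assume \<tau>: "\<tau> \<in> {0..1}" and "e > 0"
    \<comment> \<open>A modulus at \<open>\<tau>\<close> common to all \<open>x\<close> in
      \<open>D\<close>: the \<open>d\<close> term is constant in \<open>t\<close> and cancels, and
      \<open>Bc * (\<psi> R * A)\<close> bounds the coefficient of \<open>v\<close>.\<close>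
    define E where "E = (\<lambda>t. \<psi> R * integral\<^sup>L M (\<lambda>s. \<bar>k t s - k \<tau> s\<bar> * \<phi> s) + Bc * (\<psi> R * A) * \<bar>v t - v \<tau>\<bar>)"
    have "((\<lambda>t. v t - v \<tau>) \<longlongrightarrow> 0) (at \<tau> within {0..1})"
      using v \<tau> by (simp add: continuous_on_def LIM_zero)
    then have "(E \<longlongrightarrow> 0) (at \<tau> within {0..1})"
      unfolding E_def
      by (intro tendsto_add_zero tendsto_mult_right_zero tendsto_rabs_zero k_cont[OF \<tau>])
    from tendstoD[OF this \<open>e > 0\<close>] obtain \<delta> where "\<delta> > 0"
      and \<delta>: "\<And>t. t \<in> {0..1} \<Longrightarrow> t \<noteq> \<tau> \<Longrightarrow> dist t \<tau> < \<delta> \<Longrightarrow> \<bar>E t\<bar> < e"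
      unfolding eventually_at by auto
    have "\<bar>T x \<tau> - T x t\<bar> < e" if x: "x \<in> D" and t: "t \<in> {0..1}" and "\<bar>\<tau> - t\<bar> < \<delta>" for x t
    proof (cases "t = \<tau>")
      case False
      have "\<bar>c (K (g x))\<bar> \<le> Bc * (\<psi> R * A)"
        using Bc(2)[OF dom[OF x]] mult_left_mono[OF gA[OF x] Bc(1)] by linarith
      then have "\<bar>c (K (g x)) * (v t - v \<tau>)\<bar> \<le> Bc * (\<psi> R * A) * \<bar>v t - v \<tau>\<bar>"
        unfolding abs_mult by (rule mult_right_mono) simp
      moreover have "T x t - T x \<tau> = (K (g x) t - K (g x) \<tau>) + c (K (g x)) * (v t - v \<tau>)"
        by (simp add: T_def algebra_simps)
      ultimately have "\<bar>T x t - T x \<tau>\<bar> \<le> E t"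
        unfolding E_def using K_modulus[OF dom[OF x] t \<tau>] by linarith
      moreover have "\<bar>E t\<bar> < e" using \<delta>[OF t False] that(3) by (simp add: dist_real_def abs_minus_commute)
      ultimately show ?thesis by (simp add: abs_minus_commute)
    qed (use \<open>e > 0\<close> in simp)
    with \<open>\<delta> > 0\<close> show "\<exists>\<delta>>0. \<forall>x\<in>D. \<forall>t\<in>{0..1}. \<bar>\<tau> - t\<bar> < \<delta> \<longrightarrow> \<bar>T x \<tau> - T x t\<bar> < e" by blast
  qed blast
  show ?thesis
    using that[OF dom[OF x(1), unfolded g_def]] x(2) unfolding T_def g_def by metis
qed

end

section \<open>Elimination of the two functionals\<close>

theorem theorem4p6:
  fixes \<alpha> \<beta> :: "(real \<Rightarrow> real) \<Rightarrow> real"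
    and v w :: "real \<Rightarrow> real"
    and p :: ereal and q :: real
    and f :: "real \<Rightarrow> real \<Rightarrow> real"
    and \<psi> \<phi> :: "real \<Rightarrow> real"
    and k :: "real \<Rightarrow> real \<Rightarrow> real"
    and m :: "real \<Rightarrow> real"
  assumes \<alpha>: "\<alpha> \<in> CBV_dual" and \<beta>: "\<beta> \<in> CBV_dual"
    and vw: "v \<in> CBV" "w \<in> CBV"
    and e0: "\<alpha> (\<lambda>t. 1) = 0" "\<beta> (\<lambda>t. 1) = 0"
    and small: "\<bar>\<alpha> v - \<beta> v\<bar> < 1"
    and sum1: "\<forall>t\<in>{0..1}. v t + w t = 1"
    and p: "p > 1" and q: "q \<ge> 1"
    and pq: "(if p = \<infinity> then q = 1 else 1 / real_of_ereal p + 1 / q = 1)"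
    and f_meas: "\<forall>u. (\<lambda>t. f t u) \<in> borel_measurable (lebesgue_on {0..1})"
    and f_cont: "AE t in lebesgue_on {0..1}. continuous_on UNIV (f t)"
    and \<psi>_mono: "mono_on {0..} \<psi>" and \<psi>_nonneg: "\<forall>r\<ge>0. \<psi> r \<ge> 0"
    and \<phi>_Lp: "Lp01 p \<phi>" and \<phi>_nonneg: "\<forall>t\<in>{0..1}. \<phi> t \<ge> 0"
    and f_bound: "\<forall>t\<in>{0..1}. \<forall>u. \<bar>f t u\<bar> \<le> \<phi> t * \<psi> \<bar>u\<bar>"
    and \<psi>_sublin: "((\<lambda>r. \<psi> r / r) \<longlongrightarrow> 0) at_top"
    and k_Lq: "\<forall>t\<in>{0..1}. Lp01 (ereal q) (k t)"
    and m_Lq: "Lp01 (ereal q) m" and m_nonneg: "\<forall>s\<in>{0..1}. m s \<ge> 0"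
    and k_var: "AE s in lebesgue_on {0..1}. jvar (\<lambda>t. k t s) 0 1 \<le> ereal (m s)"
    and k_cont: "\<forall>\<tau>\<in>{0..1}.
       ((\<lambda>t. integral\<^sup>L (lebesgue_on {0..1}) (\<lambda>s. \<bar>k t s - k \<tau> s\<bar> * \<phi> s)) \<longlongrightarrow> 0)
         (at \<tau> within {0..1})"
  shows "\<exists>x\<in>CBV. \<forall>t\<in>{0..1}.
           integrable (lebesgue_on {0..1}) (\<lambda>s. k t s * f s (x s)) \<and>
           x t = \<alpha> x * v t + \<beta> x * w t
                 + integral\<^sup>L (lebesgue_on {0..1}) (\<lambda>s. k t s * f s (x s))"
proof -
  interpret variation_kernel k m \<phi>
  proof
    show "integrable (lebesgue_on {0..1}) (\<lambda>s. k 0 s * \<phi> s)"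
      using k_Lq by (intro integrable_Lp01_mult[OF p q pq \<phi>_Lp]) auto
    show "integrable (lebesgue_on {0..1}) (\<lambda>s. m s * \<phi> s)"
      by (rule integrable_Lp01_mult[OF p q pq \<phi>_Lp m_Lq])
  qed (use k_Lq m_Lq \<phi>_Lp m_nonneg \<phi>_nonneg k_var k_cont in \<open>auto simp: Lp01_def\<close>)
  \<comment> \<open>Applying \<open>\<alpha>\<close> and \<open>\<beta>\<close> to
    \<open>x = (\<alpha> x - \<beta> x) v + \<beta> x + y\<close> and subtracting gives
    \<open>r * (\<alpha> x - \<beta> x) = \<alpha> y - \<beta> y\<close>. Hence \<open>c y\<close>
    is to be \<open>\<alpha> x - \<beta> x\<close>, and \<open>d y\<close> is to be
    \<open>\<beta> x\<close>; the smallness assumption makes \<open>r\<close> nonzero.\<close>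
  define r where "r = 1 - (\<alpha> v - \<beta> v)"
  have "r \<noteq> 0" using small by (auto simp: r_def)
  define c where "c = (\<lambda>y. (1 / r) * \<alpha> y + (- 1 / r) * \<beta> y)"
  define d where "d = (\<lambda>y. \<beta> v * c y + 1 * \<beta> y)"
  have c: "c \<in> CBV_dual" unfolding c_def by (rule CBV_dual_lincomb[OF \<alpha> \<beta>])
  have d: "d \<in> CBV_dual" unfolding d_def by (rule CBV_dual_lincomb[OF c \<beta>])
  obtain x0 C where dom0: "dominated C (\<lambda>s. f s (x0 s))" and x0: "\<And>t. t \<in> {0..1} \<Longrightarrow>
      x0 t = K (\<lambda>s. f s (x0 s)) t + c (K (\<lambda>s. f s (x0 s))) * v t + d (K (\<lambda>s. f s (x0 s)))"
  proof (rule hammerstein_fixed_point[OF c d _ _ f_cont \<psi>_mono _ _ \<psi>_sublin])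
    show "continuous_on {0..1} v" using vw(1) by (simp add: CBV_def)
  qed (use f_meas \<psi>_nonneg f_bound in simp_all)
  define y where "y = K (\<lambda>s. f s (x0 s))"
  \<comment> \<open>The equation for \<open>x0\<close> is known on [0,1] only. Redefining the
    solution by its formula on the whole line makes it literally a linear combination in
    \<open>CBV\<close>, to which linearity applies twice.\<close>
  define x where "x = (\<lambda>t. 1 * (1 * y t + c y * v t) + d y * 1)"
  have y: "y \<in> CBV" unfolding y_def by (rule K_CBV[OF dom0])
  have yv: "(\<lambda>t. 1 * y t + c y * v t) \<in> CBV" by (rule CBV_lincomb[OF y vw(1)])
  have x: "x \<in> CBV" unfolding x_def by (rule CBV_lincomb[OF yv CBV_const])
  have eval: "\<theta> x = \<theta> y + c y * \<theta> v" if "\<theta> \<in> CBV_dual" "\<theta> (\<lambda>t. 1) = 0" for \<theta>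
    unfolding x_def CBV_dual_linear[OF that(1) yv CBV_const]
    unfolding CBV_dual_linear[OF that(1) y vw(1)] using that(2) by simp
  have cy: "c y * r = \<alpha> y - \<beta> y" using \<open>r \<noteq> 0\<close> by (simp add: c_def field_simps)
  have \<beta>x: "\<beta> x = d y" using eval[OF \<beta> e0(2)] by (simp add: d_def)
  have \<alpha>x: "\<alpha> x = c y + d y"
    using eval[OF \<alpha> e0(1)] cy by (simp add: d_def r_def algebra_simps)
  have xx0: "x t = x0 t" if "t \<in> {0..1}" for t
    using x0[OF that] by (simp add: x_def y_def)
  show ?thesis
  proof (intro bexI[OF _ x] ballI conjI)
    fix t :: real assume t: "t \<in> {0..1}"
    have "integrable M (\<lambda>s. k t s * f s (x0 s)) \<longleftrightarrow> integrable M (\<lambda>s. k t s * f s (x s))"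
      by (rule Bochner_Integration.integrable_cong) (auto simp: xx0)
    with K_integrable[OF dom0 t] show "integrable M (\<lambda>s. k t s * f s (x s))" by simp
    have I: "integral\<^sup>L M (\<lambda>s. k t s * f s (x s)) = y t"
      unfolding y_def K_def by (rule Bochner_Integration.integral_cong) (auto simp: xx0)
    have wt: "w t = 1 - v t" using sum1 t by (simp add: eq_diff_eq add.commute)
    have xt: "x t = y t + c y * v t + d y" by (simp add: x_def)
    \<comment> \<open>With \<open>w = 1 - v\<close> on [0,1], the boundary terms
      \<open>(c y + d y) * v t + d y * (1 - v t)\<close> collapse to
      \<open>c y * v t + d y\<close>.\<close>
    show "x t = \<alpha> x * v t + \<beta> x * w t + integral\<^sup>L M (\<lambda>s. k t s * f s (x s))"
      unfolding I wt xt \<alpha>x \<beta>x by (simp add: algebra_simps)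
  qed
qed

end
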